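(* Let $G>0$, $R>0$, let $X\subseteq\mathbb{R}^d$ be a nonempty closed convex set, and let $f:\mathbb{R}^d\to\mathbb{R}$ be convex, with a minimizer $x^*\in\operatorname{argmin}_{x\in X}f(x)$, and such that $\|g\|\le G$ for all $x\in X$ and all $g\in\partial f(x)$. Let $N\ge 1$ be an integer, let $\gamma\in(0,\tfrac12]$, and set $h=R/N^{\gamma}$. Let $x^1\in X$ satisfy $\|x^1-x^*\|\le R$, and let $x^1,\dots,x^{N+1}$ and $g^1,\dots,g^N$ be generated by $N$ iterations of AdaGrad with parameter $h$ from $x^1$ (with arbitrary choices of subgradients $g^k\in\partial f(x^k)$). Let $\delta\in[0,\tfrac12]$ be such that $$G^2+\sum_{i=1}^{N-1}\|g^i\|^2=G^2N^{2\delta}.$$ Then $$f(x^{N+1})-f(x^* )\le \frac{GR}{2}\left(\frac{N^{\gamma}\sqrt{N^{2\delta}+1}}{2N+1}+\frac{N^{-\gamma}\left(4\log(N^{2\delta})+5\right)\sqrt{N^{2\delta}+1}}{2\max\{N^{2\delta}-1,1\}}+N^{-\gamma-2\delta}\sqrt{N^{2\delta}+1}+N^{-\gamma-\delta}\right).$$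
   Context: $\|\cdot\|$ is the Euclidean norm on $\mathbb{R}^d$, $\partial f(x)=\{g\in\mathbb{R}^d: f(y)\ge f(x)+\langle g,y-x\rangle\ \forall y\in\mathbb{R}^d\}$, and $P_X(y)=\operatorname{argmin}_{x\in X}\|x-y\|$ is the Euclidean projection onto $X$. $\log$ is the natural logarithm. AdaGrad (scalar stepsizes) with parameter $h>0$, run for $N$ iterations from $x^1\in X$: for $k=1,\dots,N$, receive some $g^k\in\partial f(x^k)$ and set $$x^{k+1}=P_X(x^k-h_kg^k),\qquad h_k=\frac{h}{\sqrt{G^2+\sum_{i=1}^{k}\|g^i\|^2}}.$$ The last iterate is $x^{N+1}$. Since $0\le\|g^i\|\le G$, a number $\delta\in[0,\frac12]$ as in the claim always exists; for $N\ge2$ it is $\delta=\frac12\log_N\bigl(1+\sum_{i=1}^{N-1}\|g^i\|^2/G^2\bigr)$. *)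

theory Defs
  imports "HOL-Analysis.Analysis"
begin

definition subdifferential :: "('a::real_inner \<Rightarrow> real) \<Rightarrow> 'a \<Rightarrow> 'a set" where
  "subdifferential f x = {g. \<forall>y. f y \<ge> f x + inner g (y - x)}"

definition adagrad_stepsize :: "real \<Rightarrow> real \<Rightarrow> (nat \<Rightarrow> 'a::real_normed_vector) \<Rightarrow> nat \<Rightarrow> real" where
  "adagrad_stepsize G h g k = h / sqrt (G\<^sup>2 + (\<Sum>i=1..k. (norm (g i))\<^sup>2))"

text \<open>
  The sequences are indexed from 1: only \<open>x 1, \<dots>, x (N + 1)\<close> and \<open>g 1, \<dots>, g N\<close> are
  constrained. Being a relation, this leaves the choice of each subgradient arbitrary.
  The Euclidean projection onto a nonempty closed convex \<open>X\<close> is \<^const>\<open>closest_point\<close>.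
\<close>
definition adagrad_run ::
  "'a::euclidean_space set \<Rightarrow> ('a \<Rightarrow> real) \<Rightarrow> real \<Rightarrow> real \<Rightarrow> nat \<Rightarrow> (nat \<Rightarrow> 'a) \<Rightarrow> (nat \<Rightarrow> 'a) \<Rightarrow> bool" where
  "adagrad_run X f G h N x g \<longleftrightarrow>
     x 1 \<in> X \<and>
     (\<forall>k\<in>{1..N}. g k \<in> subdifferential f (x k) \<and>
        x (k + 1) = closest_point X (x k - adagrad_stepsize G h g k *\<^sub>R g k))"

end

theory Submission
  imports Defs
begin

text \<open>
  The bound on the last iterate comes from comparing the iterates with moving reference points
  in \<open>X\<close> instead of with the minimizer. Starting from \<open>z\<^sub>0 = x\<^sup>*\<close>, each reference point \<open>z\<^sub>k\<close> is
  an average of \<open>z\<^sub>k\<^sub>-\<^sub>1\<close> and the iterate \<open>x\<^sub>k\<close>. Moving the reference point towards \<open>x\<^sub>k\<close>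
  raises its function value by at most a multiple of \<open>\<langle>g\<^sub>k, x\<^sub>k - z\<^sub>k\<^sub>-\<^sub>1\<rangle>\<close>, and the projected
  subgradient step lowers the squared distance to it by a multiple of the same quantity. With
  weights \<open>w\<^sub>k = c + 2 \<Sum>\<^sub>i\<^sub>\<ge>\<^sub>k h\<^sub>i\<close> the two cancel (\<open>projected_step_toward_average\<close>), so that
  \<open>f(z\<^sub>k) + \<parallel>x\<^sub>k\<^sub>+\<^sub>1 - z\<^sub>k\<parallel>\<^sup>2 / (2 w\<^sub>k\<^sub>+\<^sub>1)\<close> grows in each step only by
  \<open>h\<^sub>k\<^sup>2 \<parallel>g\<^sub>k\<parallel>\<^sup>2 / (2 w\<^sub>k\<^sub>+\<^sub>1)\<close>. At the end a single subgradient inequality at \<open>x\<^sub>N\<^sub>+\<^sub>1\<close>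
  against the last reference point turns this into a bound on \<open>f(x\<^sub>N\<^sub>+\<^sub>1)\<close>
  (\<open>last_iterate_bound\<close>). The weights \<open>w\<^sub>k\<close> involve later stepsizes, which is harmless because the
  reference points occur only in the analysis.

  For AdaGrad take \<open>c = h\<^sub>N\<close>. The stepsizes decrease, so \<open>w\<^sub>k \<ge> h\<^sub>N (2 (N - k) + 3)\<close>. For \<open>k = 1\<close> this
  produces the factor \<open>1 / (2 N + 1)\<close>. In the normalized form \<open>a\<^sub>k = \<parallel>g\<^sub>k\<parallel>\<^sup>2 / G\<^sup>2\<close>,
  \<open>A\<^sub>k = 1 + a\<^sub>1 + \<dots> + a\<^sub>k\<close>, the gradient terms become
  \<open>a\<^sub>k / A\<^sub>k\<close> divided by the remaining time \<open>2 (N - k) + 1\<close>. Since \<open>a\<^sub>i \<le> 1\<close>, the remaining time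
  is at least of the order of the remaining growth of \<open>A\<close>; hence a large \<open>a\<^sub>k / A\<^sub>k\<close>
  (small \<open>A\<^sub>k\<close>) must occur early, and the sum is of order \<open>ln A / A\<close> with \<open>A = A\<^sub>N\<^sub>-\<^sub>1 = N\<^sup>2\<^sup>\<delta>\<close>
  (\<open>sum_self_normalized_weighted_le\<close>). The step \<open>k = N\<close> and the final subgradient each
  contribute at most \<open>h\<^sub>N G\<^sup>2 / 2\<close>.
\<close>

section \<open>Existence of subgradients\<close>

text \<open>
  A hyperplane separating \<open>(x, f x)\<close> from the strict epigraph cannot be vertical because \<open>f\<close> is
  finite on the whole space; its slope is a subgradient.
\<close>

lemma subdifferential_nonempty:
  fixes f :: "'a::euclidean_space \<Rightarrow> real"
  assumes "convex_on UNIV f"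
  shows "subdifferential f x \<noteq> {}"
proof -
  define E where "E = {(y, t). f y < t}"
  have "convex E"
  proof (rule convexI)
    fix p q :: "'a \<times> real" and u v :: real
    assume pq: "p \<in> E" "q \<in> E" and uv: "0 \<le> u" "0 \<le> v" "u + v = 1"
    obtain y s z t where [simp]: "p = (y, s)" "q = (z, t)" by (metis surj_pair)
    have *: "f y < s" "f z < t" using pq by (auto simp: E_def)
    have "f (u *\<^sub>R y + v *\<^sub>R z) \<le> u * f y + v * f z"
      using assms uv by (auto simp: convex_on_def)
    also have "\<dots> < u * s + v * t"
    proof (cases "u = 0")
      case True
      then show ?thesis using uv * by simp
    next
      case False
      then have "u * f y < u * s" using uv * by simp
      moreover have "v * f z \<le> v * t" using uv * by (intro mult_left_mono) auto
      ultimately show ?thesis by linarith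
    qed
    finally show "u *\<^sub>R p + v *\<^sub>R q \<in> E" by (simp add: E_def)
  qed
  moreover have "(x, f x + 1) \<in> E" "(x, f x) \<notin> E" by (auto simp: E_def)
  ultimately obtain a b where "a \<noteq> 0" and a1: "inner a (x, f x) \<le> b"
    and a2: "\<And>p. p \<in> E \<Longrightarrow> b \<le> inner a p"
    using separating_hyperplane_sets[of "{(x, f x)}" E] by blast
  obtain p q where [simp]: "a = (p, q)" by (metis surj_pair)
  have sep: "inner p x + q * f x \<le> inner p y + q * t" if "f y < t" for y t
    using a1 a2[of "(y, t)"] that by (auto simp: E_def)
  have "q \<ge> 0" using sep[of x "f x + 1"] by (simp add: algebra_simps)
  \<comment> \<open>For a vertical hyperplane, \<open>x\<close> would minimize \<open>\<langle>p, _\<rangle>\<close> over the whole space.\<close>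
  have "q \<noteq> 0"
  proof
    assume [simp]: "q = 0"
    have "inner p p \<le> 0"
      using sep[of "x - p" "f (x - p) + 1"] by (simp add: inner_diff_right)
    then have "p = 0" by (metis inner_eq_zero_iff inner_ge_zero order_antisym)
    with \<open>a \<noteq> 0\<close> show False by (simp add: zero_prod_def)
  qed
  with \<open>q \<ge> 0\<close> have "q > 0" by simp
  have "f x + inner (- (1 / q) *\<^sub>R p) (y - x) \<le> f y" for y
  proof (rule field_le_epsilon)
    fix e :: real assume "e > 0"
    then show "f x + inner (- (1 / q) *\<^sub>R p) (y - x) \<le> f y + e"
      using sep[of y "f y + e"] \<open>q > 0\<close> by (simp add: field_simps inner_diff_right)
  qed
  then have "- (1 / q) *\<^sub>R p \<in> subdifferential f x" by (simp add: subdifferential_def)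
  then show ?thesis by blast
qed

section \<open>Last iterate of the projected subgradient method\<close>

text \<open>
  One step of the argument for the last iterate. With \<open>z' = \<rho> z + (1 - \<rho>) x\<close>, convexity gives
  \<open>f z' - f z \<le> (1 - \<rho>) \<langle>g, x - z\<rangle>\<close>, while \<open>x - z' = \<rho> (x - z)\<close> makes the squared distance to
  \<open>z'\<close> drop by \<open>2 h \<rho> \<langle>g, x - z\<rangle>\<close>. The ratio \<open>\<rho> = w / (w + h)\<close> is the one for which these inner
  products cancel after division of the squared distance by \<open>2 w\<close>; the old distance is left with
  the coefficient \<open>w / (2 (w + h)\<^sup>2) \<le> 1 / (2 (w + 2 h))\<close>, which is why the weights of
  consecutive steps differ by \<open>2 h\<close>.
\<close>
lemma projected_step_toward_average:
  fixes f :: "'a::euclidean_space \<Rightarrow> real"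
  assumes X: "closed X" "convex X" and f: "convex_on X f" and xz: "x \<in> X" "z \<in> X"
    and g: "g \<in> subdifferential f x" and h: "h > 0" and w: "w > 0"
    and z': "z' = (w / (w + h)) *\<^sub>R z + (h / (w + h)) *\<^sub>R x"
  shows "f z' + (norm (closest_point X (x - h *\<^sub>R g) - z'))\<^sup>2 / (2 * w)
    \<le> f z + (norm (x - z))\<^sup>2 / (2 * (w + 2 * h)) + h\<^sup>2 * (norm g)\<^sup>2 / (2 * w)"
proof -
  define \<rho> where "\<rho> = w / (w + h)"
  have \<rho>: "0 < \<rho>" "\<rho> < 1" "1 - \<rho> = h / (w + h)"
    using h w by (auto simp: \<rho>_def field_simps)
  have z'\<rho>: "z' = \<rho> *\<^sub>R z + (1 - \<rho>) *\<^sub>R x" by (simp add: z' \<rho>(3)) (simp add: \<rho>_def)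
  have z'X: "z' \<in> X" unfolding z'\<rho> using \<open>convex X\<close> xz \<rho> by (intro convexD) auto
  have diff: "x - z' = \<rho> *\<^sub>R (x - z)" by (simp add: z'\<rho> algebra_simps)
  let ?i = "inner g (x - z)"
  have "f z' \<le> \<rho> * f z + (1 - \<rho>) * f x"
    unfolding z'\<rho> using f xz \<rho>(1,2) by (auto simp: convex_on_def)
  also have "f x \<le> f z + ?i"
  proof -
    have "f x + inner g (z - x) \<le> f z" using g by (auto simp: subdifferential_def)
    then show ?thesis by (simp add: inner_diff_right)
  qed
  then have "\<rho> * f z + (1 - \<rho>) * f x \<le> f z + (1 - \<rho>) * ?i"
    using mult_left_mono[of "f x" "f z + ?i" "1 - \<rho>"] \<rho>(1,2) by (simp add: algebra_simps)
  finally have descent: "f z' \<le> f z + (1 - \<rho>) * ?i" .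
  have "norm (closest_point X (x - h *\<^sub>R g) - z') \<le> norm (x - h *\<^sub>R g - z')"
    using closest_point_lipschitz[OF X(2,1), of "x - h *\<^sub>R g" z'] z'X closest_point_self[OF z'X]
    by (auto simp: dist_norm)
  then have "(norm (closest_point X (x - h *\<^sub>R g) - z'))\<^sup>2 \<le> (norm (\<rho> *\<^sub>R (x - z) - h *\<^sub>R g))\<^sup>2"
    by (metis diff add.commute diff_diff_eq norm_ge_zero power_mono)
  also have "\<dots> = \<rho>\<^sup>2 * (norm (x - z))\<^sup>2 - 2 * h * \<rho> * ?i + h\<^sup>2 * (norm g)\<^sup>2"
    unfolding power2_norm_eq_inner
    by (simp add: inner_diff_left inner_diff_right inner_commute power2_eq_square algebra_simps)
  finally have "(norm (closest_point X (x - h *\<^sub>R g) - z'))\<^sup>2 / (2 * w)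
      \<le> (\<rho>\<^sup>2 * (norm (x - z))\<^sup>2 - 2 * h * \<rho> * ?i + h\<^sup>2 * (norm g)\<^sup>2) / (2 * w)"
    using w by (intro divide_right_mono) auto
  also have "\<dots> = \<rho>\<^sup>2 / w * (norm (x - z))\<^sup>2 / 2 - (1 - \<rho>) * ?i + h\<^sup>2 * (norm g)\<^sup>2 / (2 * w)"
  proof -
    have "h * \<rho> / w = 1 - \<rho>" unfolding \<rho>(3) using w by (simp add: \<rho>_def)
    then have "2 * h * \<rho> * ?i / (2 * w) = (1 - \<rho>) * ?i" by (metis (no_types) mult.assoc mult_divide_mult_cancel_left times_divide_eq_left zero_neq_numeral)
    then show ?thesis by (simp add: add_divide_distrib diff_divide_distrib)
  qed
  also have "\<rho>\<^sup>2 / w * (norm (x - z))\<^sup>2 / 2 \<le> (norm (x - z))\<^sup>2 / (2 * (w + 2 * h))"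
  proof -
    have "w * (w + 2 * h) \<le> (w + h)\<^sup>2" by (simp add: power2_eq_square algebra_simps)
    then have "w / (w + h)\<^sup>2 \<le> w / (w * (w + 2 * h))"
      using w h by (intro divide_left_mono) auto
    moreover have "\<rho>\<^sup>2 / w = w / (w + h)\<^sup>2"
      using w by (simp add: \<rho>_def power_divide) (simp add: power2_eq_square)
    ultimately have "\<rho>\<^sup>2 / w \<le> 1 / (w + 2 * h)" using w by simp
    then have "\<rho>\<^sup>2 / w * (norm (x - z))\<^sup>2 / 2 \<le> 1 / (w + 2 * h) * (norm (x - z))\<^sup>2 / 2"
      by (intro divide_right_mono mult_right_mono) auto
    moreover have "1 / p * q / 2 = q / (2 * p)" for p q :: real by simp
    ultimately show ?thesis by metis
  qed
  finally show ?thesis using descent by linarith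
qed

lemma projected_iterates_mem:
  fixes x :: "nat \<Rightarrow> 'a::euclidean_space"
  assumes "closed X" and "x 1 \<in> X"
    and upd: "\<And>k. k \<in> {1..N} \<Longrightarrow> x (k + 1) = closest_point X (y k)"
    and "1 \<le> k" and "k \<le> N + 1"
  shows "x k \<in> X"
  using assms(4,5)
proof (induction k rule: dec_induct)
  case (step n)
  then have "x (Suc n) = closest_point X (y n)" using upd[of n] by simp
  then show ?case using closest_point_in_set[OF assms(1)] assms(2) by auto
qed (use assms in simp)

text \<open>
  The one-step inequality is iterated backwards from the end of the run, for all comparison points
  \<open>z\<close> at once: the bound from step \<open>m\<close> on relative to \<open>z\<close> follows from the bound from step
  \<open>m + 1\<close> on relative to the average of \<open>z\<close> and \<open>x m\<close>. The parameter \<open>c\<close> balances the two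
  parts of the subgradient inequality at the last iterate and acts there like a further stepsize.
\<close>
lemma last_iterate_bound:
  fixes f :: "'a::euclidean_space \<Rightarrow> real"
  assumes X: "closed X" "convex X" and f: "convex_on UNIV f"
    and G: "\<And>y v. y \<in> X \<Longrightarrow> v \<in> subdifferential f y \<Longrightarrow> norm v \<le> G"
    and x1: "x 1 \<in> X"
    and g: "\<And>k. k \<in> {1..N} \<Longrightarrow> g k \<in> subdifferential f (x k)"
    and upd: "\<And>k. k \<in> {1..N} \<Longrightarrow> x (k + 1) = closest_point X (x k - h k *\<^sub>R g k)"
    and h: "\<And>k. k \<in> {1..N} \<Longrightarrow> h k > 0" and c: "c > 0"
    and z: "z \<in> X"
  shows "f (x (N + 1)) - f z \<le> (norm (x 1 - z))\<^sup>2 / (2 * (c + 2 * (\<Sum>k=1..N. h k)))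
    + (\<Sum>k=1..N. (h k)\<^sup>2 * (norm (g k))\<^sup>2 / (c + 2 * (\<Sum>i=Suc k..N. h i))) / 2 + c * G\<^sup>2 / 2"
proof -
  define w where "w m = c + 2 * (\<Sum>k=m..N. h k)" for m
  have xX: "x k \<in> X" if "1 \<le> k" "k \<le> N + 1" for k
    using projected_iterates_mem[OF X(1) x1 upd that] .
  have w: "w m > 0" if "1 \<le> m" for m
    unfolding w_def using c h that by (intro add_pos_nonneg mult_nonneg_nonneg sum_nonneg) (auto simp: less_imp_le)
  have "\<forall>z\<in>X. f (x (N + 1)) - f z \<le> (norm (x m - z))\<^sup>2 / (2 * w m)
    + (\<Sum>k=m..N. (h k)\<^sup>2 * (norm (g k))\<^sup>2 / (2 * w (Suc k))) + c * G\<^sup>2 / 2"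
    if "1 \<le> m" "m \<le> N + 1" for m
    using that(2,1)
  proof (induction m rule: inc_induct)
    case base
    show ?case
    proof
      fix z assume "z \<in> X"
      obtain v where v: "v \<in> subdifferential f (x (N + 1))"
        using subdifferential_nonempty[OF f] by blast
      let ?d = "x (N + 1) - z"
      have "f (x (N + 1)) + inner v (z - x (N + 1)) \<le> f z"
        using v by (auto simp: subdifferential_def)
      then have "f (x (N + 1)) - f z \<le> inner v ?d" by (simp add: inner_diff_right)
      also have "\<dots> \<le> G * norm ?d"
        using norm_cauchy_schwarz[of v ?d] mult_right_mono[OF G[OF xX v] norm_ge_zero[of ?d]] by auto
      \<comment> \<open>Young's inequality: expand \<open>(\<parallel>x (N + 1) - z\<parallel> - c G)\<^sup>2 \<ge> 0\<close>.\<close>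
      also have "\<dots> \<le> (norm ?d)\<^sup>2 / (2 * c) + c * G\<^sup>2 / 2"
        using zero_le_power2[of "norm ?d - c * G"] c
        by (simp add: field_simps power2_eq_square)
      finally show "f (x (N + 1)) - f z \<le> (norm (x (N + 1) - z))\<^sup>2 / (2 * w (N + 1))
        + (\<Sum>k=N + 1..N. (h k)\<^sup>2 * (norm (g k))\<^sup>2 / (2 * w (Suc k))) + c * G\<^sup>2 / 2"
        by (simp add: w_def)
    qed
  next
    case (step m)
    then have m: "m \<in> {1..N}" by simp
    show ?case
    proof
      fix z assume "z \<in> X"
      define z' where "z' = (w (Suc m) / (w (Suc m) + h m)) *\<^sub>R z + (h m / (w (Suc m) + h m)) *\<^sub>R x m"
      have wS: "w (Suc m) > 0" using w by simp
      have "z' \<in> X" unfolding z'_def using wS h[OF m] \<open>z \<in> X\<close> xX[of m] m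
        by (intro convexD[OF X(2)]) (auto simp flip: add_divide_distrib)
      then have "f (x (N + 1)) - f z' \<le> (norm (x (Suc m) - z'))\<^sup>2 / (2 * w (Suc m))
        + (\<Sum>k=Suc m..N. (h k)\<^sup>2 * (norm (g k))\<^sup>2 / (2 * w (Suc k))) + c * G\<^sup>2 / 2"
        using step.IH by simp
      moreover have "f z' + (norm (x (Suc m) - z'))\<^sup>2 / (2 * w (Suc m))
        \<le> f z + (norm (x m - z))\<^sup>2 / (2 * (w (Suc m) + 2 * h m)) + (h m)\<^sup>2 * (norm (g m))\<^sup>2 / (2 * w (Suc m))"
        using projected_step_toward_average[OF X convex_on_subset[OF f] _ \<open>z \<in> X\<close> g[OF m] h[OF m] wS z'_def]
          X xX[of m] m upd[OF m] by simp
      moreover have "w m = w (Suc m) + 2 * h m"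
        using m by (simp add: w_def sum.atLeast_Suc_atMost)
      ultimately show "f (x (N + 1)) - f z \<le> (norm (x m - z))\<^sup>2 / (2 * w m)
        + (\<Sum>k=m..N. (h k)\<^sup>2 * (norm (g k))\<^sup>2 / (2 * w (Suc k))) + c * G\<^sup>2 / 2"
        using m by (simp add: sum.atLeast_Suc_atMost)
    qed
  qed
  from this[of 1] z have "f (x (N + 1)) - f z \<le> (norm (x 1 - z))\<^sup>2 / (2 * w 1)
    + (\<Sum>k=1..N. (h k)\<^sup>2 * (norm (g k))\<^sup>2 / (2 * w (Suc k))) + c * G\<^sup>2 / 2" by simp
  also have "(\<Sum>k=1..N. (h k)\<^sup>2 * (norm (g k))\<^sup>2 / (2 * w (Suc k)))
    = (\<Sum>k=1..N. (h k)\<^sup>2 * (norm (g k))\<^sup>2 / w (Suc k)) / 2"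
    unfolding sum_divide_distrib by (simp add: mult.commute)
  finally show ?thesis unfolding w_def .
qed

section \<open>The self-normalized gradient sum\<close>

lemma divide_add_le_ln_diff:
  fixes a u :: real
  assumes "u > 0" "a \<ge> 0"
  shows "a / (u + a) \<le> ln (u + a) - ln u"
proof -
  have "ln (u / (u + a)) \<le> u / (u + a) - 1" using assms by (intro ln_le_minus_one) auto
  then show ?thesis using assms by (simp add: ln_div field_simps)
qed

text \<open>
  As each \<open>a i\<close> is at most 1, the time \<open>M - k\<close> left after \<open>k\<close> dominates the growth
  \<open>A M - A k\<close> still to come. After replacing the former by the latter, the product
  \<open>A k * (2 * (A M - A k) + 3)\<close> in the denominator splits into partial fractions, because the
  combination \<open>2 * A k + (2 * (A M - A k) + 3)\<close> does not depend on \<open>k\<close>. Either fraction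
  telescopes into a logarithm: the first as \<open>A k\<close> increases from \<open>1\<close> to \<open>A M\<close>, the second as
  \<open>A M - A k\<close> decreases to \<open>0\<close>.
\<close>
lemma sum_self_normalized_weighted_le:
  fixes a :: "nat \<Rightarrow> real" and M :: nat
  assumes a: "\<And>k. k \<in> {1..M} \<Longrightarrow> 0 \<le> a k \<and> a k \<le> 1"
  defines "A \<equiv> \<lambda>k. 1 + (\<Sum>i=1..k. a i)"
  shows "(\<Sum>k=1..M. a k / A k / (2 * (real M - real k) + 3)) \<le> (2 * ln (A M) + 1) / (2 * A M + 3)"
proof -
  have A_Suc: "A (Suc k) = A k + a (Suc k)" for k by (simp add: A_def)
  have A1: "A k \<ge> 1" if "k \<le> M" for k
    unfolding A_def using a that by (auto intro!: sum_nonneg)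
  have rest: "0 \<le> A M - A k \<and> A M - A k \<le> real M - real k" if "k \<le> M" for k
    using that
  proof (induction k rule: inc_induct)
    case base
    then show ?case by simp
  next
    case (step n)
    then show ?case using A_Suc[of n] a[of "Suc n"] by auto
  qed
  define U where "U k = ln (A k)" for k
  \<comment> \<open>The shift is \<open>1 / 2\<close> and not the \<open>3 / 2\<close> of the fraction: an increment \<open>a k \<le> 1\<close> is absorbed.\<close>
  define V where "V k = - ln (A M - A k + 1 / 2)" for k
  have "a k / A k / (2 * (real M - real k) + 3) \<le> ((U k - U (k - 1)) + (V k - V (k - 1))) / (2 * A M + 3)"
    if k: "k \<in> {1..M}" for k
  proof -
    have Ak: "A k = A (k - 1) + a k" using A_Suc[of "k - 1"] k by simp
    have ak: "0 \<le> a k" "a k \<le> 1" using a k by auto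
    have A1k: "A (k - 1) \<ge> 1" "A k \<ge> 1" using A1[of "k - 1"] A1[of k] k by auto
    let ?B = "A M - A k"
    have B: "0 \<le> ?B" "?B \<le> real M - real k" using rest[of k] k by auto
    have "a k / A k / (2 * (real M - real k) + 3) \<le> a k / A k / (2 * ?B + 3)"
      using B ak A1k by (intro divide_left_mono divide_nonneg_nonneg) auto
    also have "\<dots> = (a k / A k + a k / (?B + 3 / 2)) / (2 * A M + 3)"
    proof -
      have "A k \<noteq> 0" "2 * ?B + 3 \<noteq> 0" "2 * A M + 3 \<noteq> 0" "?B + 3 / 2 \<noteq> 0" using A1k B by auto
      then have "1 / (A k * (2 * ?B + 3)) = (1 / A k + 2 / (2 * ?B + 3)) / (2 * A M + 3)"
        by (simp add: add_frac_eq)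
      moreover have "2 / (2 * ?B + 3) = 1 / (?B + 3 / 2)" using B by (simp add: field_simps)
      ultimately have split: "1 / (A k * (2 * ?B + 3)) = (1 / A k + 1 / (?B + 3 / 2)) / (2 * A M + 3)"
        by simp
      have "a k / A k / (2 * ?B + 3) = a k * (1 / (A k * (2 * ?B + 3)))" by simp
      also have "\<dots> = (a k / A k + a k / (?B + 3 / 2)) / (2 * A M + 3)"
        unfolding split by (simp add: distrib_left)
      finally show ?thesis .
    qed
    also have "\<dots> \<le> ((U k - U (k - 1)) + (V k - V (k - 1))) / (2 * A M + 3)"
    proof (intro divide_right_mono add_mono)
      show "a k / A k \<le> U k - U (k - 1)"
        using divide_add_le_ln_diff[of "A (k - 1)" "a k"] A1k ak by (simp add: U_def Ak)
      have "a k / (?B + 3 / 2) \<le> a k / (?B + 1 / 2 + a k)"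
        using B ak by (intro divide_left_mono) auto
      also have "\<dots> \<le> ln (?B + 1 / 2 + a k) - ln (?B + 1 / 2)"
        using divide_add_le_ln_diff[of "?B + 1 / 2" "a k"] B ak by simp
      finally show "a k / (?B + 3 / 2) \<le> V k - V (k - 1)" by (simp add: V_def Ak algebra_simps)
      show "0 \<le> 2 * A M + 3" using A1[of M] by simp
    qed
    finally show ?thesis .
  qed
  then have "(\<Sum>k=1..M. a k / A k / (2 * (real M - real k) + 3))
      \<le> (\<Sum>k=1..M. ((U k - U (k - 1)) + (V k - V (k - 1))) / (2 * A M + 3))"
    by (rule sum_mono)
  also have "\<dots> = ((U M - U 0) + (V M - V 0)) / (2 * A M + 3)"
    using sum_telescope''[of 0 M U] sum_telescope''[of 0 M V]
    by (simp flip: sum_divide_distrib add: sum.distrib)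
  also have "\<dots> \<le> (2 * ln (A M) + 1) / (2 * A M + 3)"
  proof (rule divide_right_mono)
    have AM: "A M \<ge> 1" using A1 by simp
    have "V M - V 0 = ln (2 * A M - 1)"
    proof -
      have "ln (A M - 1 + 1 / 2) = ln ((2 * A M - 1) * (1/2))" by (simp add: field_simps)
      also have "\<dots> = ln (2 * A M - 1) + ln (1/2)" using AM by (subst ln_mult) auto
      finally show ?thesis by (simp add: V_def A_def)
    qed
    also have "\<dots> \<le> ln (2 * A M)" using AM by simp
    also have "\<dots> \<le> ln (A M) + 1" using AM ln_le_minus_one[of 2] by (simp add: ln_mult)
    finally show "U M - U 0 + (V M - V 0) \<le> 2 * ln (A M) + 1" by (simp add: U_def A_def)
    show "0 \<le> 2 * A M + 3" using AM by simp
  qed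
  finally show ?thesis .
qed


section \<open>AdaGrad\<close>

text \<open>
  The general bound with \<open>c = h N\<close>. The last stepsize is controlled from both sides by the first
  \<open>N - 1\<close> subgradients alone: it is at most \<open>\<eta> / (G \<surd>D)\<close>, and since \<open>\<parallel>g N\<parallel> \<le> G\<close> it is at
  least \<open>\<eta> / (G \<surd>(D + 1))\<close>.
\<close>
lemma adagrad_last_iterate:
  fixes f :: "'a::euclidean_space \<Rightarrow> real"
  assumes X: "closed X" "convex X" and f: "convex_on UNIV f"
    and G: "\<And>y v. y \<in> X \<Longrightarrow> v \<in> subdifferential f y \<Longrightarrow> norm v \<le> G"
    and "G > 0" "\<eta> > 0" "N \<ge> 1"
    and run: "adagrad_run X f G \<eta> N x g"
    and z: "z \<in> X" "norm (x 1 - z) \<le> R"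
    and D: "G\<^sup>2 + (\<Sum>i=1..N-1. (norm (g i))\<^sup>2) = G\<^sup>2 * D"
  shows "f (x (N + 1)) - f z \<le>
    R\<^sup>2 * G * sqrt (D + 1) / (2 * \<eta> * (2 * real N + 1))
    + \<eta> * G * sqrt (D + 1) * (2 * ln D + 1) / (2 * (2 * D + 3))
    + \<eta> * G / sqrt D"
proof -
  define h where "h = adagrad_stepsize G \<eta> g"
  define a where "a k = (norm (g k))\<^sup>2 / G\<^sup>2" for k
  define A where "A k = 1 + (\<Sum>i=1..k. a i)" for k
  have x1: "x 1 \<in> X" and g: "\<And>k. k \<in> {1..N} \<Longrightarrow> g k \<in> subdifferential f (x k)"
    and upd: "\<And>k. k \<in> {1..N} \<Longrightarrow> x (k + 1) = closest_point X (x k - h k *\<^sub>R g k)"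
    using run by (auto simp: adagrad_run_def h_def)
  have xX: "x k \<in> X" if "1 \<le> k" "k \<le> N + 1" for k
    using projected_iterates_mem[OF X(1) x1 upd that] .
  have a: "0 \<le> a k \<and> a k \<le> 1" if "k \<in> {1..N}" for k
  proof -
    have "norm (g k) \<le> G" using G[OF xX g[OF that]] that by simp
    then show ?thesis using \<open>G > 0\<close> by (simp add: a_def divide_le_eq power_mono)
  qed
  have S: "G\<^sup>2 + (\<Sum>i=1..k. (norm (g i))\<^sup>2) = G\<^sup>2 * A k" for k
    using \<open>G > 0\<close> by (simp add: A_def a_def distrib_left flip: sum_divide_distrib)
  have hA: "h k = \<eta> / (G * sqrt (A k))" for k
    unfolding h_def adagrad_stepsize_def S using \<open>G > 0\<close> by (simp add: real_sqrt_mult)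
  have A_N1: "A (N - 1) = D" using D \<open>G > 0\<close> unfolding S by simp
  have A_mono: "A k \<le> A l" if "k \<le> l" for k l
    unfolding A_def using that by (intro add_left_mono sum_mono2) (auto simp: a_def)
  have A1: "A k \<ge> 1" for k using A_mono[of 0 k] by (simp add: A_def)
  have "D \<ge> 1" using A1[of "N - 1"] A_N1 by simp
  have A_N: "A N \<le> D + 1" "D \<le> A N"
  proof -
    have "A N = A (N - 1) + a N" using \<open>N \<ge> 1\<close> by (cases N) (auto simp: A_def)
    then show "A N \<le> D + 1" "D \<le> A N" using a[of N] \<open>N \<ge> 1\<close> A_N1 by auto
  qed
  have h_pos: "h k > 0" for k unfolding hA using A1[of k] \<open>G > 0\<close> \<open>\<eta> > 0\<close> by simp
  have h_anti: "h l \<le> h k" if "k \<le> l" for k l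
    unfolding hA using A_mono[OF that] A1[of k] A1[of l] \<open>G > 0\<close> \<open>\<eta> > 0\<close>
    by (intro divide_left_mono mult_left_mono) auto
  have inv_h: "1 / h N \<le> G * sqrt (D + 1) / \<eta>"
    unfolding hA using A_N \<open>G > 0\<close> \<open>\<eta> > 0\<close> by (auto intro!: divide_right_mono)
  define W where "W k = h N + 2 * (\<Sum>i=Suc k..N. h i)" for k
  have W: "h N * (2 * (real N - real k) + 1) \<le> W k" if "k \<le> N" for k
  proof -
    have "real (card {Suc k..N}) * h N \<le> (\<Sum>i=Suc k..N. h i)"
      by (intro sum_bounded_below h_anti) auto
    then show ?thesis using that by (simp add: W_def of_nat_diff algebra_simps)
  qed
  have q: "0 < h N * (2 * (real N - real k) + 1)" if "k \<le> N" for k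
    using h_pos that by (intro mult_pos_pos) auto
  define T where "T k = (h k)\<^sup>2 * (norm (g k))\<^sup>2 / W k" for k
  have T: "T k \<le> (h k)\<^sup>2 * (norm (g k))\<^sup>2 / (h N * (2 * (real N - real k) + 1))"
    if "k \<le> N" for k
    unfolding T_def using that
    by (intro divide_left_mono mult_pos_pos[OF less_le_trans[OF q W] q] W) auto
  have hG: "h N * G\<^sup>2 \<le> \<eta> * G / sqrt D"
  proof -
    have "h N * G\<^sup>2 = \<eta> * G / sqrt (A N)" using \<open>G > 0\<close> by (simp add: hA power2_eq_square)
    also have "\<dots> \<le> \<eta> * G / sqrt D"
      using A_N \<open>D \<ge> 1\<close> \<open>G > 0\<close> \<open>\<eta> > 0\<close> by (intro divide_left_mono) auto
    finally show ?thesis .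
  qed
  have T_N: "T N \<le> \<eta> * G / sqrt D"
  proof -
    have "T N \<le> h N * (norm (g N))\<^sup>2" using T[of N] h_pos[of N] by (simp add: power2_eq_square)
    also have "\<dots> \<le> h N * G\<^sup>2"
      using G[OF xX g[of N]] \<open>N \<ge> 1\<close> h_pos[of N] by (intro mult_left_mono power_mono) auto
    finally show ?thesis using hG by simp
  qed
  have T_sum: "(\<Sum>k=1..N-1. T k) \<le> \<eta> * G * sqrt (D + 1) * (2 * ln D + 1) / (2 * D + 3)"
  proof -
    have "T k \<le> \<eta>\<^sup>2 * (1 / h N) * (a k / A k / (2 * (real (N - 1) - real k) + 3))"
      if k: "k \<in> {1..N-1}" for k
    proof -
      have num: "(h k)\<^sup>2 * (norm (g k))\<^sup>2 = \<eta>\<^sup>2 * (a k / A k)"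
        using A1[of k] by (simp add: hA a_def power_divide power_mult_distrib)
      have den: "2 * (real N - real k) + 1 = 2 * (real (N - 1) - real k) + 3"
        using \<open>N \<ge> 1\<close> by (simp add: of_nat_diff)
      have "T k \<le> \<eta>\<^sup>2 * (a k / A k) / (h N * (2 * (real (N - 1) - real k) + 3))"
        using T[of k] k unfolding num den by auto
      then show ?thesis by (simp only: times_divide_eq_left times_divide_eq_right divide_divide_eq_left mult_ac mult_1)
    qed
    then have "(\<Sum>k=1..N-1. T k)
        \<le> \<eta>\<^sup>2 * (1 / h N) * (\<Sum>k=1..N-1. a k / A k / (2 * (real (N - 1) - real k) + 3))"
      unfolding sum_distrib_left by (rule sum_mono)
    also have "\<dots> \<le> \<eta>\<^sup>2 * (1 / h N) * ((2 * ln D + 1) / (2 * D + 3))"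
    proof (rule mult_left_mono)
      have "0 \<le> a k \<and> a k \<le> 1" if "k \<in> {1..N - 1}" for k using a that by auto
      from sum_self_normalized_weighted_le[of "N - 1" a, OF this]
      show "(\<Sum>k=1..N-1. a k / A k / (2 * (real (N - 1) - real k) + 3)) \<le> (2 * ln D + 1) / (2 * D + 3)"
        unfolding A_def[symmetric] A_N1 .
    qed (use h_pos[of N] in simp)
    also have "\<dots> \<le> \<eta>\<^sup>2 * (G * sqrt (D + 1) / \<eta>) * ((2 * ln D + 1) / (2 * D + 3))"
      using inv_h \<open>D \<ge> 1\<close> by (intro mult_right_mono mult_left_mono divide_nonneg_nonneg) auto
    also have "\<dots> = \<eta> * G * sqrt (D + 1) * (2 * ln D + 1) / (2 * D + 3)"
      using \<open>\<eta> > 0\<close> by (simp add: power2_eq_square)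
    finally show ?thesis .
  qed
  have first: "(norm (x 1 - z))\<^sup>2 / (2 * W 0) \<le> R\<^sup>2 * G * sqrt (D + 1) / (2 * \<eta> * (2 * real N + 1))"
  proof -
    have "(norm (x 1 - z))\<^sup>2 / (2 * W 0) \<le> R\<^sup>2 / (2 * (h N * (2 * real N + 1)))"
      using W[of 0] q[of 0] z(2) by (intro frac_le power_mono) auto
    also have "\<dots> = R\<^sup>2 / (2 * (2 * real N + 1)) * (1 / h N)" by simp
    also have "\<dots> \<le> R\<^sup>2 / (2 * (2 * real N + 1)) * (G * sqrt (D + 1) / \<eta>)"
      by (intro mult_left_mono inv_h) auto
    finally show ?thesis by (simp add: mult_ac)
  qed
  have "f (x (N + 1)) - f z \<le> (norm (x 1 - z))\<^sup>2 / (2 * W 0) + (\<Sum>k=1..N. T k) / 2 + h N * G\<^sup>2 / 2"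
    using last_iterate_bound[OF X f G x1 g upd h_pos h_pos[of N] z(1)] unfolding W_def T_def by simp
  moreover have "(\<Sum>k=1..N. T k) / 2
      \<le> \<eta> * G * sqrt (D + 1) * (2 * ln D + 1) / (2 * (2 * D + 3)) + \<eta> * G / sqrt D / 2"
  proof -
    have split: "(\<Sum>k=1..N. T k) = (\<Sum>k=1..N-1. T k) + T N"
      using \<open>N \<ge> 1\<close> by (cases N) auto
    have half: "E / (2 * q) = E / q / 2" for E q :: real by simp
    show ?thesis unfolding split half add_divide_distrib
      by (intro add_mono divide_right_mono T_sum T_N) auto
  qed
  moreover note first hG
  moreover have "F \<le> p' + q' + r'" if "F \<le> p + q + r / 2" "q \<le> q' + r' / 2" "p \<le> p'" "r \<le> r'"
    for F p q r p' q' r' :: real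
    using that by linarith
  ultimately show ?thesis by blast
qed

text \<open>
  The choice \<open>\<eta> = R / N\<^sup>\<gamma>\<close> and \<open>D = N\<^sup>2\<^sup>\<delta>\<close> turns the AdaGrad estimate into the stated
  powers of \<open>N\<close>. Of the two equal contributions \<open>\<eta> G / (2 \<surd>D)\<close> making up its last summand, one is
  enlarged with \<open>1 / \<surd>D \<le> \<surd>(D + 1) / D\<close>.
\<close>
theorem theorem4p1:
  fixes X :: "(real ^ 'd) set" and f :: "real ^ 'd \<Rightarrow> real"
    and G R \<gamma> \<delta> :: real and N :: nat
    and xstar :: "real ^ 'd" and x g :: "nat \<Rightarrow> real ^ 'd"
  assumes "G > 0" and "R > 0"
    and "X \<noteq> {}" and "closed X" and "convex X"
    and "convex_on UNIV f"
    and "is_arg_min f (\<lambda>y. y \<in> X) xstar"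
    and "\<forall>y\<in>X. \<forall>v\<in>subdifferential f y. norm v \<le> G"
    and "N \<ge> 1"
    and "0 < \<gamma>" and "\<gamma> \<le> 1 / 2"
    and "norm (x 1 - xstar) \<le> R"
    and "adagrad_run X f G (R / real N powr \<gamma>) N x g"
    and "0 \<le> \<delta>" and "\<delta> \<le> 1 / 2"
    and "G\<^sup>2 + (\<Sum>i=1..N-1. (norm (g i))\<^sup>2) = G\<^sup>2 * real N powr (2 * \<delta>)"
  shows "f (x (N + 1)) - f xstar \<le>
    G * R / 2 *
      (real N powr \<gamma> * sqrt (real N powr (2 * \<delta>) + 1) / (2 * real N + 1)
       + real N powr (- \<gamma>) * (4 * ln (real N powr (2 * \<delta>)) + 5) * sqrt (real N powr (2 * \<delta>) + 1)
           / (2 * max (real N powr (2 * \<delta>) - 1) 1)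
       + real N powr (- \<gamma> - 2 * \<delta>) * sqrt (real N powr (2 * \<delta>) + 1)
       + real N powr (- \<gamma> - \<delta>))"
proof -
  define P D where "P = real N powr \<gamma>" and "D = real N powr (2 * \<delta>)"
  have "P > 0" "D > 0" using \<open>N \<ge> 1\<close> by (auto simp: P_def D_def)
  have "D \<ge> 1" unfolding D_def using \<open>N \<ge> 1\<close> \<open>0 \<le> \<delta>\<close> by (intro ge_one_powr_ge_zero) auto
  have sqrt_D: "sqrt D = real N powr \<delta>"
    using \<open>N \<ge> 1\<close> by (simp add: D_def powr_half_sqrt[symmetric] powr_powr)
  have powr_minus_\<gamma>: "real N powr (- \<gamma>) = 1 / P"
    "real N powr (- \<gamma> - 2 * \<delta>) = 1 / P / D"
    "real N powr (- \<gamma> - \<delta>) = 1 / P / sqrt D"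
    by (auto simp: P_def D_def sqrt_D powr_diff powr_minus_divide)
      (simp add: powr_diff powr_minus_divide sqrt_D[unfolded D_def])
  have xstar: "xstar \<in> X" using assms(7) by (simp add: is_arg_min_def)
  have "f (x (N + 1)) - f xstar \<le>
      R\<^sup>2 * G * sqrt (D + 1) / (2 * (R / P) * (2 * real N + 1))
      + (R / P) * G * sqrt (D + 1) * (2 * ln D + 1) / (2 * (2 * D + 3))
      + (R / P) * G / sqrt D"
    unfolding P_def D_def
    using assms xstar by (intro adagrad_last_iterate[where X = X and g = g]) auto
  also have "R\<^sup>2 * G * sqrt (D + 1) / (2 * (R / P) * (2 * real N + 1))
      = G * R / 2 * (P * sqrt (D + 1) / (2 * real N + 1))"
    using \<open>R > 0\<close> \<open>P > 0\<close> by (simp add: power2_eq_square)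
  also have "(R / P) * G * sqrt (D + 1) * (2 * ln D + 1) / (2 * (2 * D + 3))
      \<le> G * R / 2 * (1 / P * (4 * ln D + 5) * sqrt (D + 1) / (2 * max (D - 1) 1))"
  proof -
    have "(2 * ln D + 1) / (2 * D + 3) \<le> (4 * ln D + 5) / (2 * max (D - 1) 1)"
      using \<open>D \<ge> 1\<close> by (intro frac_le) (auto simp: max_def)
    then have "(R / P) * G * sqrt (D + 1) / 2 * ((2 * ln D + 1) / (2 * D + 3))
      \<le> (R / P) * G * sqrt (D + 1) / 2 * ((4 * ln D + 5) / (2 * max (D - 1) 1))"
      using \<open>R > 0\<close> \<open>P > 0\<close> \<open>G > 0\<close> \<open>D \<ge> 1\<close> by (intro mult_left_mono) auto
    then show ?thesis by (simp add: mult_ac)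
  qed
  also have "(R / P) * G / sqrt D
      \<le> G * R / 2 * (1 / P / D * sqrt (D + 1)) + G * R / 2 * (1 / P / sqrt D)"
  proof -
    have "1 / sqrt D = sqrt D / D" using \<open>D > 0\<close> by (simp add: real_div_sqrt field_simps)
    also have "\<dots> \<le> sqrt (D + 1) / D" using \<open>D > 0\<close> by (intro divide_right_mono) auto
    finally have "G * R / 2 / P * (1 / sqrt D) \<le> G * R / 2 / P * (sqrt (D + 1) / D)"
      using \<open>R > 0\<close> \<open>P > 0\<close> \<open>G > 0\<close> by (intro mult_left_mono) auto
    then show ?thesis by (simp add: field_simps)
  qed
  finally show ?thesis
    unfolding powr_minus_\<gamma> P_def[symmetric] D_def[symmetric] by (simp add: distrib_left)
qed

end
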